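(* Let $\mathcal{L}$ be a countable first-order language, let $I=\kappa$ be an (infinite) index set, let $D$ be a countably incomplete (non-principal) ultrafilter on $I$, and let $(M_i)_{i\in I}$ be an indexed family of $\mathcal{L}$-structures. Let $\mathcal{M}=\prod_D M_i$ and let $\mu\in\mathfrak{M}_x(\mathcal{M})$. If $\mu$ is finitely approximated, then $\mu$ is pseudo-finite (with respect to $(M_i)_{i\in I}$ and $D$).
   Context: Letters $x,y$ denote finite tuples of variables. For an $\mathcal{L}$-structure $M$, $\mathcal{L}_x(M)$ is the collection of $\mathcal{L}$-formulas with parameters from $M$ and free variables $x$ (modulo equivalence in $M$), and $\mathfrak{M}_x(M)$ is the space of Keisler measures over $M$, i.e. finitely additive probability measures on $\mathcal{L}_x(M)$. For $p\in S_x(M)$, $\delta_p$ is the Dirac measure at $p$. For a finite sequence $\overline a=a_1,\dots,a_n$ in $M^x$, $\mathrm{Av}(\overline a)\in\mathfrak{M}_x(M)$ is given by $\mathrm{Av}(\overline a)(\psi(x))=\frac{|\{1\le i\le n: M\models\psi(a_i)\}|}{n}$. Let $\mathrm{conv}_x(M)=\{\sum_{i=1}^n r_i\delta_{\mathrm{tp}(a_i/M)}: n\ge 1,\ a_i\in M^x,\ r_i>0,\ \sum_{i=1}^n r_i=1\}$. A measure $\mu\in\mathfrak{M}_x(M)$ is finitely approximated if for every partitioned $\mathcal{L}$-formula $\varphi(x,y)$ and every $\epsilon>0$ there is a finite sequence $\overline a=a_1,\dots,a_n\in M^x$ with $\sup_{b\in M^y}|\mu(\varphi(x,b))-\mathrm{Av}(\overline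 a)(\varphi(x,b))|<\epsilon$. Elements of $\mathcal{M}=\prod_D M_i$ are written $\mathbf{b}$, and $(\mathbf{b}(i))_{i\in I}$ is a choice of representative. Given $\mu_i\in\mathfrak{M}_x(M_i)$, the ultralimit $\lim_D\mu_i\in\mathfrak{M}_x(\mathcal{M})$ is the (well-defined) measure with $(\lim_D\mu_i)(\varphi(x,\mathbf{b}))=\lim_D\mu_i(\varphi(x,\mathbf{b}(i)))$ for all $\varphi(x,\mathbf{b})\in\mathcal{L}_x(\mathcal{M})$, where $\lim_D$ on the right is the ultralimit of a bounded family of reals. A measure $\mu\in\mathfrak{M}_x(\mathcal{M})$ is pseudo-finite (with respect to $(M_i)_{i\in I}$ and $D$) if there are $\mu_i\in\mathrm{conv}_x(M_i)$, $i\in I$, with $\lim_D\mu_i=\mu$. An ultrafilter $D$ on $I$ is countably incomplete if there is $\{X_i:i\in\mathbb{N}\}\subseteq D$ with $\bigcap_{i\in\mathbb{N}}X_i=\emptyset$. All ultrafilters are non-principal. *)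

theory Defs
  imports Complex_Main "HOL-Library.FuncSet" "HOL-Library.Countable_Set"
begin

subsection \<open>First-order languages, structures and formulas\<close>

record ('f, 'r) language =
  Funs :: "'f set"
  Rels :: "'r set"
  farity :: "'f \<Rightarrow> nat"
  rarity :: "'r \<Rightarrow> nat"

definition countable_language :: "('f, 'r) language \<Rightarrow> bool" where
  "countable_language L \<longleftrightarrow> countable (Funs L) \<and> countable (Rels L)"

record ('f, 'r, 'a) fo_structure =
  universe :: "'a set"
  fn :: "'f \<Rightarrow> 'a list \<Rightarrow> 'a"
  rl :: "'r \<Rightarrow> 'a list \<Rightarrow> bool"

definition is_structure :: "('f, 'r) language \<Rightarrow> ('f, 'r, 'a) fo_structure \<Rightarrow> bool" where
  "is_structure L M \<longleftrightarrow> universe M \<noteq> {} \<and>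
     (\<forall>f\<in>Funs L. \<forall>as. length as = farity L f \<longrightarrow> set as \<subseteq> universe M \<longrightarrow> fn M f as \<in> universe M)"

text \<open>Variables are natural numbers. Elements of type \<open>'a\<close> may occur in terms as parameters
  (constants naming themselves). The generated functions \<open>params\<close> and \<open>map_fm id id h\<close> collect the
  parameters of a formula and replace each parameter \<open>c\<close> by \<open>h c\<close>.\<close>

datatype (trm_funs: 'f, trm_params: 'a) trm =
    Var nat
  | Par 'a
  | Fn 'f "('f, 'a) trm list"

datatype (fm_funs: 'f, fm_rels: 'r, params: 'a) fm =
    FF
  | Eq "('f, 'a) trm" "('f, 'a) trm"
  | Rel 'r "('f, 'a) trm list"
  | Neg "('f, 'r, 'a) fm"
  | Or "('f, 'r, 'a) fm" "('f, 'r, 'a) fm"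
  | Ex nat "('f, 'r, 'a) fm"

abbreviation TT :: "('f, 'r, 'a) fm" where "TT \<equiv> Neg FF"

primrec wf_trm :: "('f, 'r) language \<Rightarrow> ('f, 'a) trm \<Rightarrow> bool" where
  "wf_trm L (Var n) \<longleftrightarrow> True"
| "wf_trm L (Par c) \<longleftrightarrow> True"
| "wf_trm L (Fn f ts) \<longleftrightarrow> f \<in> Funs L \<and> length ts = farity L f \<and> (\<forall>b\<in>set (map (wf_trm L) ts). b)"

primrec wf_fm :: "('f, 'r) language \<Rightarrow> ('f, 'r, 'a) fm \<Rightarrow> bool" where
  "wf_fm L FF \<longleftrightarrow> True"
| "wf_fm L (Eq s t) \<longleftrightarrow> wf_trm L s \<and> wf_trm L t"
| "wf_fm L (Rel r ts) \<longleftrightarrow> r \<in> Rels L \<and> length ts = rarity L r \<and> (\<forall>t\<in>set ts. wf_trm L t)"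
| "wf_fm L (Neg \<phi>) \<longleftrightarrow> wf_fm L \<phi>"
| "wf_fm L (Or \<phi> \<psi>) \<longleftrightarrow> wf_fm L \<phi> \<and> wf_fm L \<psi>"
| "wf_fm L (Ex n \<phi>) \<longleftrightarrow> wf_fm L \<phi>"

primrec fv_trm :: "('f, 'a) trm \<Rightarrow> nat set" where
  "fv_trm (Var n) = {n}"
| "fv_trm (Par c) = {}"
| "fv_trm (Fn f ts) = \<Union> (set (map fv_trm ts))"

primrec fv :: "('f, 'r, 'a) fm \<Rightarrow> nat set" where
  "fv FF = {}"
| "fv (Eq s t) = fv_trm s \<union> fv_trm t"
| "fv (Rel r ts) = (\<Union>t\<in>set ts. fv_trm t)"
| "fv (Neg \<phi>) = fv \<phi>"
| "fv (Or \<phi> \<psi>) = fv \<phi> \<union> fv \<psi>"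
| "fv (Ex n \<phi>) = fv \<phi> - {n}"

primrec val :: "('f, 'r, 'a) fo_structure \<Rightarrow> (nat \<Rightarrow> 'a) \<Rightarrow> ('f, 'a) trm \<Rightarrow> 'a" where
  "val M v (Var n) = v n"
| "val M v (Par c) = c"
| "val M v (Fn f ts) = fn M f (map (val M v) ts)"

primrec sat :: "('f, 'r, 'a) fo_structure \<Rightarrow> (nat \<Rightarrow> 'a) \<Rightarrow> ('f, 'r, 'a) fm \<Rightarrow> bool" where
  "sat M v FF \<longleftrightarrow> False"
| "sat M v (Eq s t) \<longleftrightarrow> val M v s = val M v t"
| "sat M v (Rel r ts) \<longleftrightarrow> rl M r (map (val M v) ts)"
| "sat M v (Neg \<phi>) \<longleftrightarrow> \<not> sat M v \<phi>"
| "sat M v (Or \<phi> \<psi>) \<longleftrightarrow> sat M v \<phi> \<or> sat M v \<psi>"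
| "sat M v (Ex n \<phi>) \<longleftrightarrow> (\<exists>c\<in>universe M. sat M (v(n := c)) \<phi>)"

text \<open>\<open>formulas L A X\<close>: the \<open>L\<close>-formulas with parameters from \<open>A\<close> and free variables in \<open>X\<close>.
  For \<open>A = {}\<close> these are the plain \<open>L\<close>-formulas.\<close>

definition formulas :: "('f, 'r) language \<Rightarrow> 'a set \<Rightarrow> nat set \<Rightarrow> ('f, 'r, 'a) fm set" where
  "formulas L A X = {\<phi>. wf_fm L \<phi> \<and> params \<phi> \<subseteq> A \<and> fv \<phi> \<subseteq> X}"

text \<open>A finite tuple \<open>x\<close> of variables is given by the finite set \<open>X\<close> of its members, and
  \<open>M\<^sup>x\<close> consists of the functions from \<open>X\<close> to the universe.\<close>

definition tuples :: "('f, 'r, 'a) fo_structure \<Rightarrow> nat set \<Rightarrow> (nat \<Rightarrow> 'a) set" where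
  "tuples M X = X \<rightarrow>\<^sub>E universe M"

text \<open>\<open>Lx L M X\<close> is the set of representatives of \<open>L\<^sub>x(M)\<close>; the quotient by \<open>fm_equiv\<close> is
  accounted for in \<open>keisler_measures\<close> by invariance.\<close>

definition Lx :: "('f, 'r) language \<Rightarrow> ('f, 'r, 'a) fo_structure \<Rightarrow> nat set \<Rightarrow> ('f, 'r, 'a) fm set" where
  "Lx L M X = formulas L (universe M) X"

definition fm_equiv ::
  "('f, 'r, 'a) fo_structure \<Rightarrow> nat set \<Rightarrow> ('f, 'r, 'a) fm \<Rightarrow> ('f, 'r, 'a) fm \<Rightarrow> bool" where
  "fm_equiv M X \<phi> \<psi> \<longleftrightarrow> (\<forall>a\<in>tuples M X. sat M a \<phi> \<longleftrightarrow> sat M a \<psi>)"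

text \<open>\<open>inst Y b \<phi>\<close> is \<open>\<phi>(x, b)\<close>: the free occurrences of the variables in \<open>Y\<close> are replaced by
  the parameters given by \<open>b\<close>.\<close>

primrec inst_trm :: "nat set \<Rightarrow> (nat \<Rightarrow> 'a) \<Rightarrow> ('f, 'a) trm \<Rightarrow> ('f, 'a) trm" where
  "inst_trm Y b (Var n) = (if n \<in> Y then Par (b n) else Var n)"
| "inst_trm Y b (Par c) = Par c"
| "inst_trm Y b (Fn f ts) = Fn f (map (inst_trm Y b) ts)"

primrec inst :: "nat set \<Rightarrow> (nat \<Rightarrow> 'a) \<Rightarrow> ('f, 'r, 'a) fm \<Rightarrow> ('f, 'r, 'a) fm" where
  "inst Y b FF = FF"
| "inst Y b (Eq s t) = Eq (inst_trm Y b s) (inst_trm Y b t)"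
| "inst Y b (Rel r ts) = Rel r (map (inst_trm Y b) ts)"
| "inst Y b (Neg \<phi>) = Neg (inst Y b \<phi>)"
| "inst Y b (Or \<phi> \<psi>) = Or (inst Y b \<phi>) (inst Y b \<psi>)"
| "inst Y b (Ex n \<phi>) = Ex n (inst (Y - {n}) b \<phi>)"


subsection \<open>Keisler measures\<close>

text \<open>Measures are extensional functions on \<open>Lx L M X\<close>, so that equality of functions is
  equality of measures.\<close>

definition keisler_measures ::
  "('f, 'r) language \<Rightarrow> ('f, 'r, 'a) fo_structure \<Rightarrow> nat set \<Rightarrow> (('f, 'r, 'a) fm \<Rightarrow> real) set" where
  "keisler_measures L M X = {\<mu> \<in> Lx L M X \<rightarrow>\<^sub>E {0..1}.
     (\<forall>\<phi>\<in>Lx L M X. \<forall>\<psi>\<in>Lx L M X. fm_equiv M X \<phi> \<psi> \<longrightarrow> \<mu> \<phi> = \<mu> \<psi>) \<and>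
     \<mu> TT = 1 \<and>
     (\<forall>\<phi>\<in>Lx L M X. \<forall>\<psi>\<in>Lx L M X. (\<forall>a\<in>tuples M X. \<not> (sat M a \<phi> \<and> sat M a \<psi>)) \<longrightarrow>
        \<mu> (Or \<phi> \<psi>) = \<mu> \<phi> + \<mu> \<psi>)}"

definition tp ::
  "('f, 'r) language \<Rightarrow> ('f, 'r, 'a) fo_structure \<Rightarrow> nat set \<Rightarrow> (nat \<Rightarrow> 'a) \<Rightarrow> ('f, 'r, 'a) fm set" where
  "tp L M X a = {\<phi> \<in> Lx L M X. sat M a \<phi>}"

definition dirac ::
  "('f, 'r) language \<Rightarrow> ('f, 'r, 'a) fo_structure \<Rightarrow> nat set \<Rightarrow> ('f, 'r, 'a) fm set
    \<Rightarrow> ('f, 'r, 'a) fm \<Rightarrow> real" where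
  "dirac L M X p = (\<lambda>\<phi>\<in>Lx L M X. if \<phi> \<in> p then 1 else 0)"

definition Av ::
  "('f, 'r) language \<Rightarrow> ('f, 'r, 'a) fo_structure \<Rightarrow> nat set \<Rightarrow> (nat \<Rightarrow> 'a) list
    \<Rightarrow> ('f, 'r, 'a) fm \<Rightarrow> real" where
  "Av L M X as = (\<lambda>\<psi>\<in>Lx L M X. real (card {k. k < length as \<and> sat M (as ! k) \<psi>}) / real (length as))"

definition conv ::
  "('f, 'r) language \<Rightarrow> ('f, 'r, 'a) fo_structure \<Rightarrow> nat set \<Rightarrow> (('f, 'r, 'a) fm \<Rightarrow> real) set" where
  "conv L M X =
     {(\<lambda>\<phi>\<in>Lx L M X. \<Sum>k<n. r k * dirac L M X (tp L M X (a k)) \<phi>) | (n :: nat) r a.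
        n \<ge> 1 \<and> (\<forall>k<n. a k \<in> tuples M X) \<and> (\<forall>k<n. r k > 0) \<and> (\<Sum>k<n. r k) = 1}"

definition finitely_approximated ::
  "('f, 'r) language \<Rightarrow> ('f, 'r, 'a) fo_structure \<Rightarrow> nat set \<Rightarrow> (('f, 'r, 'a) fm \<Rightarrow> real) \<Rightarrow> bool" where
  "finitely_approximated L M X \<mu> \<longleftrightarrow>
     (\<forall>Y \<phi> \<epsilon>. finite Y \<longrightarrow> X \<inter> Y = {} \<longrightarrow> \<phi> \<in> formulas L {} (X \<union> Y) \<longrightarrow> \<epsilon> > 0 \<longrightarrow>
        (\<exists>as. as \<noteq> [] \<and> set as \<subseteq> tuples M X \<and>
           (SUP b\<in>tuples M Y. \<bar>\<mu> (inst Y b \<phi>) - Av L M X as (inst Y b \<phi>)\<bar>) < \<epsilon>))"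


subsection \<open>Ultraproducts and ultralimits\<close>

text \<open>The index set is the type \<open>'i\<close>; a set \<open>S\<close> belongs to the filter \<open>D\<close> iff
  \<open>eventually (\<lambda>i. i \<in> S) D\<close>.\<close>

definition ultrafilter :: "'i filter \<Rightarrow> bool" where
  "ultrafilter D \<longleftrightarrow> D \<noteq> bot \<and> (\<forall>P. eventually P D \<or> eventually (\<lambda>i. \<not> P i) D)"

definition nonprincipal :: "'i filter \<Rightarrow> bool" where
  "nonprincipal D \<longleftrightarrow> (\<forall>i. D \<noteq> principal {i})"

definition countably_incomplete :: "'i filter \<Rightarrow> bool" where
  "countably_incomplete D \<longleftrightarrow>
     (\<exists>S :: nat \<Rightarrow> 'i set. (\<forall>n. eventually (\<lambda>i. i \<in> S n) D) \<and> (\<Inter>n. S n) = {})"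

definition up_rel :: "'i filter \<Rightarrow> ('i \<Rightarrow> ('f, 'r, 'a) fo_structure) \<Rightarrow> (('i \<Rightarrow> 'a) \<times> ('i \<Rightarrow> 'a)) set" where
  "up_rel D M = {(f, g). f \<in> (\<Pi> i\<in>UNIV. universe (M i)) \<and> g \<in> (\<Pi> i\<in>UNIV. universe (M i)) \<and>
                         eventually (\<lambda>i. f i = g i) D}"

text \<open>\<open>rep b i\<close> is the \<open>i\<close>-th coordinate of a chosen representative of the class \<open>b\<close>.\<close>

definition rep :: "('i \<Rightarrow> 'a) set \<Rightarrow> 'i \<Rightarrow> 'a" where
  "rep b = (SOME f. f \<in> b)"

definition ultraproduct ::
  "'i filter \<Rightarrow> ('i \<Rightarrow> ('f, 'r, 'a) fo_structure) \<Rightarrow> ('f, 'r, ('i \<Rightarrow> 'a) set) fo_structure" where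
  "ultraproduct D M =
     \<lparr> universe = (\<Pi> i\<in>UNIV. universe (M i)) // up_rel D M,
       fn = (\<lambda>f bs. up_rel D M `` {\<lambda>i. fn (M i) f (map (\<lambda>b. rep b i) bs)}),
       rl = (\<lambda>r bs. eventually (\<lambda>i. rl (M i) r (map (\<lambda>b. rep b i) bs)) D) \<rparr>"

text \<open>For \<open>\<phi> = \<phi>(x, b)\<close> with parameters \<open>b\<close> in the ultraproduct, \<open>map_fm id id (\<lambda>b. rep b i) \<phi>\<close>
  is \<open>\<phi>(x, b(i))\<close>.\<close>

definition ultralimit ::
  "('f, 'r) language \<Rightarrow> 'i filter \<Rightarrow> ('i \<Rightarrow> ('f, 'r, 'a) fo_structure) \<Rightarrow> nat set
    \<Rightarrow> ('i \<Rightarrow> ('f, 'r, 'a) fm \<Rightarrow> real) \<Rightarrow> ('f, 'r, ('i \<Rightarrow> 'a) set) fm \<Rightarrow> real" where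
  "ultralimit L D M X \<mu>s =
     (\<lambda>\<phi>\<in>Lx L (ultraproduct D M) X. Lim D (\<lambda>i. \<mu>s i (map_fm id id (\<lambda>b. rep b i) \<phi>)))"

definition pseudo_finite ::
  "('f, 'r) language \<Rightarrow> 'i filter \<Rightarrow> ('i \<Rightarrow> ('f, 'r, 'a) fo_structure) \<Rightarrow> nat set
    \<Rightarrow> (('f, 'r, ('i \<Rightarrow> 'a) set) fm \<Rightarrow> real) \<Rightarrow> bool" where
  "pseudo_finite L D M X \<mu> \<longleftrightarrow>
     (\<exists>\<mu>s. (\<forall>i. \<mu>s i \<in> conv L (M i) X) \<and> ultralimit L D M X \<mu>s = \<mu>)"

end

theory Submission imports Defs begin

text \<open>The measures witnessing pseudo-finiteness are coordinates of averages. Since the language is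
  countable, so is the set of parameter-free formulas \<open>\<phi>\<^sub>0, \<phi>\<^sub>1, \<dots>\<close>, and every formula over the
  ultraproduct is an instance of some \<open>\<phi>\<^sub>k(x, y)\<close> (\<open>formula_is_instance\<close>). Finite approximation
  speaks of one formula at a time, but finitely many formulas can be coded into one, so for each
  \<open>m\<close> there is a list \<open>A m\<close> of tuples whose average is within \<open>1/(m+1)\<close> of \<open>\<mu>\<close> on all instances of
  \<open>\<phi>\<^sub>0, \<dots>, \<phi>\<^sub>m\<close> (\<open>simultaneous_approximation\<close>).

  It remains to choose, for each index \<open>i\<close>, which of the lists \<open>A m\<close> to read off at coordinate \<open>i\<close>.
  If \<open>m \<le> n\<close>, then by the triangle inequality the averages of \<open>A m\<close> and \<open>A n\<close> differ by at most
  \<open>2/(m+1)\<close> on all instances of \<open>\<phi>\<^sub>0, \<dots>, \<phi>\<^sub>m\<close>. This comparison does not mention \<open>\<mu>\<close> any more, and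
  Los's theorem carries it over to almost all coordinates, uniformly in the parameters
  (\<open>uniform_closeness_transfers\<close>). Countable incompleteness gives a function \<open>N\<close> on the index set that
  tends to infinity along \<open>D\<close> and is such that, for almost all \<open>i\<close>, the comparison with
  \<open>n = N i\<close> holds at \<open>i\<close> (\<open>countably_incomplete_diagonal\<close>). Let \<open>\<mu>\<^sub>i\<close> be the average of the
  \<open>i\<close>-th coordinates of \<open>A (N i)\<close>. For fixed \<open>m\<close>, on an instance of \<open>\<phi>\<^sub>k\<close> with \<open>k \<le> m\<close>, almost every
  \<open>\<mu>\<^sub>i\<close> is within \<open>2/(m+1)\<close> of the coordinate of \<open>A m\<close>. The latter has, almost everywhere, the same value
  as the average of \<open>A m\<close> in the ultraproduct, which is within \<open>1/(m+1)\<close> of \<open>\<mu>\<close>. So the ultralimit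
  is \<open>\<mu>\<close>.\<close>

section \<open>Syntax and satisfaction\<close>

lemma val_cong:
  "(\<And>n. n \<in> fv_trm t \<Longrightarrow> v n = w n) \<Longrightarrow> val M v t = val M w t"
proof (induction t)
  case (Fn f ts)
  have "map (val M v) ts = map (val M w) ts" by (rule map_cong) (use Fn in auto)
  then show ?case by (simp only: val.simps)
qed auto

lemma sat_cong:
  "(\<And>n. n \<in> fv \<phi> \<Longrightarrow> v n = w n) \<Longrightarrow> sat M v \<phi> \<longleftrightarrow> sat M w \<phi>"
proof (induction \<phi> arbitrary: v w)
  case (Eq s t)
  then show ?case using val_cong[of s v w M] val_cong[of t v w M] by simp
next
  case (Rel r ts)
  then have "map (val M v) ts = map (val M w) ts" by (auto intro!: val_cong)
  then show ?case by (simp only: sat.simps)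
next
  case (Neg \<phi>)
  from Neg.IH[of v w] Neg.prems show ?case by simp
next
  case (Or \<phi> \<psi>)
  from Or.IH(1)[of v w] Or.IH(2)[of v w] Or.prems show ?case by simp
next
  case (Ex n \<phi>)
  have "sat M (v(n := c)) \<phi> \<longleftrightarrow> sat M (w(n := c)) \<phi>" for c
    by (rule Ex.IH) (use Ex.prems in auto)
  then show ?case by simp
qed simp

lemma finite_fv_trm: "finite (fv_trm t)"
  by (induction t) auto

lemma finite_fv: "finite (fv \<phi>)"
  by (induction \<phi>) (auto simp: finite_fv_trm)

lemma wf_trm_map: "wf_trm L (map_trm id h t) \<longleftrightarrow> wf_trm L t"
  by (induction t) auto

lemma wf_fm_map: "wf_fm L (map_fm id id h \<phi>) \<longleftrightarrow> wf_fm L \<phi>"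
  by (induction \<phi>) (auto simp: wf_trm_map simp flip: id_def)

lemma fv_trm_map: "fv_trm (map_trm id h t) = fv_trm t"
  by (induction t) auto

lemma fv_map: "fv (map_fm id id h \<phi>) = fv \<phi>"
  by (induction \<phi>) (auto simp: fv_trm_map simp flip: id_def)

lemma wf_trm_inst: "wf_trm L (inst_trm Y b t) \<longleftrightarrow> wf_trm L t"
  by (induction t) auto

lemma wf_fm_inst: "wf_fm L (inst Y b \<phi>) \<longleftrightarrow> wf_fm L \<phi>"
  by (induction \<phi> arbitrary: Y) (auto simp: wf_trm_inst)

lemma fv_inst_trm: "fv_trm (inst_trm Y b t) = fv_trm t - Y"
  by (induction t) auto

lemma fv_inst: "fv (inst Y b \<phi>) = fv \<phi> - Y"
  by (induction \<phi> arbitrary: Y) (auto simp: fv_inst_trm)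

lemma params_inst_trm: "trm_params (inst_trm Y b t) \<subseteq> trm_params t \<union> b ` Y"
  by (induction t) auto

lemma params_inst: "params (inst Y b \<phi>) \<subseteq> params \<phi> \<union> b ` Y"
proof (induction \<phi> arbitrary: Y)
  case (Eq s t)
  show ?case using params_inst_trm[of Y b s] params_inst_trm[of Y b t] by auto
next
  case (Rel r ts)
  show ?case using params_inst_trm[of Y b] by fastforce
next
  case (Ex n \<phi>)
  show ?case using Ex.IH[of "Y - {n}"] by auto
qed fastforce+

lemma inst_in_Lx:
  assumes "\<phi> \<in> formulas L {} (X \<union> Y)" "b \<in> tuples M Y"
  shows "inst Y b \<phi> \<in> Lx L M X"
  using assms params_inst[of Y b \<phi>]
  by (fastforce simp: Lx_def formulas_def tuples_def wf_fm_inst fv_inst)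

lemma val_inst: "val M v (inst_trm Y b t) = val M (\<lambda>n. if n \<in> Y then b n else v n) t"
  by (induction t) (auto intro!: arg_cong[where f = "fn M _"])

lemma sat_inst: "sat M v (inst Y b \<phi>) \<longleftrightarrow> sat M (\<lambda>n. if n \<in> Y then b n else v n) \<phi>"
proof (induction \<phi> arbitrary: v Y)
  case (Rel r ts)
  then show ?case by (auto simp: val_inst comp_def)
next
  case (Ex n \<phi>)
  have "(\<lambda>m. if m \<in> Y - {n} then b m else (v(n := c)) m)
      = (\<lambda>m. if m \<in> Y then b m else v m)(n := c)" for c by auto
  then show ?case using Ex.IH by simp
qed (auto simp: val_inst)

text \<open>The coordinate of an instance depends on the parameters only through their coordinates:
  below, \<open>h\<close> takes the \<open>i\<close>-th coordinate of an element of the ultraproduct.\<close>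

lemma map_inst_trm_cong:
  "(\<And>n. n \<in> Y \<Longrightarrow> h (b n) = h (c n)) \<Longrightarrow>
    map_trm id h (inst_trm Y b t) = map_trm id h (inst_trm Y c t)"
  by (induction t) auto

lemma map_inst_cong:
  "(\<And>n. n \<in> Y \<Longrightarrow> h (b n) = h (c n)) \<Longrightarrow>
    map_fm id id h (inst Y b \<phi>) = map_fm id id h (inst Y c \<phi>)"
proof (induction \<phi> arbitrary: Y)
  case (Ex n \<phi>)
  have "map_fm id id h (inst (Y - {n}) b \<phi>) = map_fm id id h (inst (Y - {n}) c \<phi>)"
    by (rule Ex.IH) (use Ex.prems in auto)
  then show ?case by (simp flip: id_def)
qed (auto intro: map_inst_trm_cong simp flip: id_def)


section \<open>Every formula is an instance of one of countably many\<close>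

primrec bv :: "('f, 'r, 'a) fm \<Rightarrow> nat set" where
  "bv FF = {}"
| "bv (Eq s t) = {}"
| "bv (Rel r ts) = {}"
| "bv (Neg \<phi>) = bv \<phi>"
| "bv (Or \<phi> \<psi>) = bv \<phi> \<union> bv \<psi>"
| "bv (Ex n \<phi>) = insert n (bv \<phi>)"

primrec params_to_vars_trm :: "('a \<Rightarrow> nat) \<Rightarrow> ('f, 'a) trm \<Rightarrow> ('f, 'a) trm" where
  "params_to_vars_trm g (Var n) = Var n"
| "params_to_vars_trm g (Par c) = Var (g c)"
| "params_to_vars_trm g (Fn f ts) = Fn f (map (params_to_vars_trm g) ts)"

primrec params_to_vars :: "('a \<Rightarrow> nat) \<Rightarrow> ('f, 'r, 'a) fm \<Rightarrow> ('f, 'r, 'a) fm" where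
  "params_to_vars g FF = FF"
| "params_to_vars g (Eq s t) = Eq (params_to_vars_trm g s) (params_to_vars_trm g t)"
| "params_to_vars g (Rel r ts) = Rel r (map (params_to_vars_trm g) ts)"
| "params_to_vars g (Neg \<phi>) = Neg (params_to_vars g \<phi>)"
| "params_to_vars g (Or \<phi> \<psi>) = Or (params_to_vars g \<phi>) (params_to_vars g \<psi>)"
| "params_to_vars g (Ex n \<phi>) = Ex n (params_to_vars g \<phi>)"

lemma finite_bv: "finite (bv \<phi>)"
  by (induction \<phi>) auto

lemma finite_trm_params: "finite (trm_params t)"
  by (induction t) auto

lemma finite_params: "finite (params \<phi>)"
  by (induction \<phi>) (auto simp: finite_trm_params)

lemma wf_params_to_vars_trm: "wf_trm L (params_to_vars_trm g t) \<longleftrightarrow> wf_trm L t"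
  by (induction t) auto

lemma wf_params_to_vars: "wf_fm L (params_to_vars g \<phi>) \<longleftrightarrow> wf_fm L \<phi>"
  by (induction \<phi>) (auto simp: wf_params_to_vars_trm)

lemma params_params_to_vars_trm: "trm_params (params_to_vars_trm g t) = {}"
  by (induction t) auto

lemma params_params_to_vars: "params (params_to_vars g \<phi>) = {}"
  by (induction \<phi>) (auto simp: params_params_to_vars_trm)

lemma fv_params_to_vars_trm: "fv_trm (params_to_vars_trm g t) = fv_trm t \<union> g ` trm_params t"
  by (induction t) auto

lemma fv_params_to_vars:
  "g ` params \<phi> \<inter> bv \<phi> = {} \<Longrightarrow> fv (params_to_vars g \<phi>) = fv \<phi> \<union> g ` params \<phi>"
proof (induction \<phi>)
  case (Rel r ts)
  then show ?case by (auto simp: fv_params_to_vars_trm)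
next
  case (Or \<phi> \<psi>)
  then have "g ` params \<phi> \<inter> bv \<phi> = {}" "g ` params \<psi> \<inter> bv \<psi> = {}" by auto
  then show ?case using Or.IH by auto
next
  case (Ex n \<phi>)
  then have "g ` params \<phi> \<inter> bv \<phi> = {}" "n \<notin> g ` params \<phi>" by auto
  then show ?case using Ex.IH by auto
qed (auto simp: fv_params_to_vars_trm)

lemma inst_params_to_vars_trm:
  "(\<And>c. c \<in> trm_params t \<Longrightarrow> g c \<in> Y \<and> b (g c) = c) \<Longrightarrow> Y \<inter> fv_trm t = {} \<Longrightarrow>
    inst_trm Y b (params_to_vars_trm g t) = t"
proof (induction t)
  case (Fn f ts)
  have "inst_trm Y b (params_to_vars_trm g t) = t" if "t \<in> set ts" for t
    using that Fn.prems by (intro Fn.IH) auto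
  then show ?case by (simp add: map_idI)
qed auto

lemma inst_params_to_vars:
  "(\<And>c. c \<in> params \<phi> \<Longrightarrow> g c \<in> Y \<and> b (g c) = c) \<Longrightarrow> Y \<inter> (fv \<phi> \<union> bv \<phi>) = {} \<Longrightarrow>
    inst Y b (params_to_vars g \<phi>) = \<phi>"
proof (induction \<phi>)
  case (Eq s t)
  then show ?case using inst_params_to_vars_trm[of s g Y b] inst_params_to_vars_trm[of t g Y b]
    by auto
next
  case (Rel r ts)
  have "inst_trm Y b (params_to_vars_trm g t) = t" if "t \<in> set ts" for t
    using that Rel.prems by (intro inst_params_to_vars_trm) auto
  then show ?case by (simp add: map_idI)
next
  case (Or \<phi> \<psi>)
  have "inst Y b (params_to_vars g \<phi>) = \<phi>" by (rule Or.IH(1)) (use Or.prems in auto)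
  moreover have "inst Y b (params_to_vars g \<psi>) = \<psi>" by (rule Or.IH(2)) (use Or.prems in auto)
  ultimately show ?case by simp
next
  case (Ex n \<phi>)
  have "inst Y b (params_to_vars g \<phi>) = \<phi>" by (rule Ex.IH) (use Ex.prems in auto)
  moreover have "Y - {n} = Y" using Ex.prems by auto
  ultimately show ?case by simp
qed auto

text \<open>Naming the parameters by variables that are neither in \<open>X\<close> nor bound in \<open>\<psi>\<close> avoids capture, so
  substituting them back returns \<open>\<psi>\<close> itself and not just an equivalent formula. The tuple of
  parameter variables can then be recovered from \<open>\<phi>\<close> as \<open>fv \<phi> - X\<close>, which makes an enumeration of
  the formulas \<open>\<phi>\<close> alone sufficient.\<close>

lemma formula_is_instance:
  assumes "\<psi> \<in> Lx L M X" "finite X"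
  obtains \<phi> b where "wf_fm L \<phi>" "params \<phi> = {}" "b \<in> tuples M (fv \<phi> - X)"
    "\<psi> = inst (fv \<phi> - X) b \<phi>"
proof -
  have \<psi>: "wf_fm L \<psi>" "params \<psi> \<subseteq> universe M" "fv \<psi> \<subseteq> X"
    using assms(1) by (auto simp: Lx_def formulas_def)
  have "infinite (- (X \<union> bv \<psi>))"
    using assms(2) finite_bv[of \<psi>] finite_compl[of "X \<union> bv \<psi>"] by (simp del: Compl_Un)
  then obtain T where T: "finite T" "card T = card (params \<psi>)" "T \<subseteq> - (X \<union> bv \<psi>)"
    using infinite_arbitrarily_large by blast
  then obtain g where "bij_betw g (params \<psi>) T"
    using finite_same_card_bij[OF finite_params] by metis
  then have g: "inj_on g (params \<psi>)" "g ` params \<psi> \<subseteq> - (X \<union> bv \<psi>)"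
    using T(3) by (auto simp: bij_betw_def)
  let ?\<phi> = "params_to_vars g \<psi>"
  have Y: "fv ?\<phi> - X = g ` params \<psi>"
  proof -
    have "g ` params \<psi> \<inter> bv \<psi> = {}" using g(2) by auto
    from fv_params_to_vars[OF this] show ?thesis using g(2) \<psi>(3) by auto
  qed
  let ?b = "restrict (inv_into (params \<psi>) g) (g ` params \<psi>)"
  have "?b \<in> tuples M (fv ?\<phi> - X)"
    using \<psi>(2) g(1) by (auto simp: tuples_def Y)
  moreover have "inst (fv ?\<phi> - X) ?b ?\<phi> = \<psi>"
    using g \<psi>(3) unfolding Y by (intro inst_params_to_vars) auto
  ultimately show thesis
    using that[of ?\<phi> ?b] \<psi>(1) by (simp add: wf_params_to_vars params_params_to_vars)
qed

instance trm :: (countable, countable) countable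
  by countable_datatype

instance fm :: (countable, countable, countable) countable
  by countable_datatype

lemma trm_funs_wf: "wf_trm L t \<Longrightarrow> trm_funs t \<subseteq> Funs L"
  by (induction t) auto

lemma fm_funs_wf: "wf_fm L \<phi> \<Longrightarrow> fm_funs \<phi> \<subseteq> Funs L"
  by (induction \<phi>) (auto dest: trm_funs_wf)

lemma fm_rels_wf: "wf_fm L \<phi> \<Longrightarrow> fm_rels \<phi> \<subseteq> Rels L"
  by (induction \<phi>) auto

text \<open>The types of symbols may be uncountable; only the symbols of \<open>L\<close> occur in a well-formed formula.
  Numbering them embeds the formulas into a countable type.\<close>

lemma countable_parameter_free:
  assumes "countable_language L"
  shows "countable {\<phi> :: ('f, 'r, 'a) fm. wf_fm L \<phi> \<and> params \<phi> = {}}" (is "countable ?F")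
proof -
  let ?h = "map_fm (to_nat_on (Funs L)) (to_nat_on (Rels L)) (\<lambda>_. ())"
  have inj: "inj_on (to_nat_on (Funs L)) (Funs L)" "inj_on (to_nat_on (Rels L)) (Rels L)"
    using assms by (auto simp: countable_language_def)
  have "inj_on ?h ?F"
  proof (rule inj_onI)
    fix \<phi> \<psi> :: "('f, 'r, 'a) fm"
    assume *: "\<phi> \<in> ?F" "\<psi> \<in> ?F" "?h \<phi> = ?h \<psi>"
    show "\<phi> = \<psi>"
      by (rule fm.inj_map_strong[OF _ _ _ *(3)])
        (use * inj fm_funs_wf[of L] fm_rels_wf[of L] in \<open>auto dest!: inj_onD simp: subset_iff\<close>)
  qed
  then show ?thesis by (rule countable_image_inj_on[rotated]) simp
qed


section \<open>Simultaneous approximation on finitely many formulas\<close>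

text \<open>With fresh variables \<open>u\<close> and \<open>w\<close>, the formula \<open>(u = w \<longrightarrow> \<phi>) \<and> (u \<noteq> w \<longrightarrow> \<psi>)\<close> specialises to \<open>\<phi>\<close>
  or to \<open>\<psi>\<close> according to whether the parameters put for \<open>u\<close> and \<open>w\<close> agree. Two distinct elements
  are needed for this.\<close>

lemma combine_two_formulas:
  assumes "\<phi> \<in> formulas L {} (X \<union> Y)" "finite Y" "X \<inter> Y = {}"
    and "\<psi> \<in> formulas L {} (X \<union> Z)" "finite Z" "X \<inter> Z = {}"
    and "finite X" "p \<in> universe N" "q \<in> universe N" "p \<noteq> q"
  obtains \<theta> W where "\<theta> \<in> formulas L {} (X \<union> W)" "finite W" "X \<inter> W = {}"
    "\<And>b. b \<in> tuples N Y \<Longrightarrow> \<exists>c\<in>tuples N W. fm_equiv N X (inst Y b \<phi>) (inst W c \<theta>)"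
    "\<And>b. b \<in> tuples N Z \<Longrightarrow> \<exists>c\<in>tuples N W. fm_equiv N X (inst Z b \<psi>) (inst W c \<theta>)"
proof -
  have fin: "finite (X \<union> Y \<union> Z)" using assms by auto
  obtain u where u: "u \<notin> X \<union> Y \<union> Z" using ex_new_if_finite[OF _ fin] by auto
  obtain w where w: "w \<notin> insert u (X \<union> Y \<union> Z)"
    using ex_new_if_finite[of "insert u (X \<union> Y \<union> Z)"] fin by auto
  let ?W = "Y \<union> Z \<union> {u, w}"
  let ?e = "Eq (Var u) (Var w)"
  \<comment> \<open>the equivalent disjunctive form \<open>(u = w \<and> \<phi>) \<or> (u \<noteq> w \<and> \<psi>)\<close>\<close>
  let ?\<theta> = "Or (Neg (Or (Neg ?e) (Neg \<phi>))) (Neg (Or ?e (Neg \<psi>)))"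
  show thesis
  proof (rule that)
    show "?\<theta> \<in> formulas L {} (X \<union> ?W)" "finite ?W" "X \<inter> ?W = {}"
      using assms u w by (auto simp: formulas_def)
  next
    fix b assume b: "b \<in> tuples N Y"
    let ?c = "\<lambda>n\<in>?W. if n \<in> Y then b n else p"
    have "?c \<in> tuples N ?W" using b assms by (auto simp: tuples_def)
    moreover have "fm_equiv N X (inst Y b \<phi>) (inst ?W ?c ?\<theta>)"
      unfolding fm_equiv_def sat_inst
    proof
      fix a
      let ?v = "\<lambda>n. if n \<in> ?W then ?c n else a n"
      have "sat N (\<lambda>n. if n \<in> Y then b n else a n) \<phi> \<longleftrightarrow> sat N ?v \<phi>"
        by (rule sat_cong) (use assms u w in \<open>auto simp: formulas_def\<close>)
      moreover have "?v u = ?v w" using u w assms(10) by simp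
      ultimately show "sat N (\<lambda>n. if n \<in> Y then b n else a n) \<phi> \<longleftrightarrow> sat N ?v ?\<theta>"
        unfolding sat.simps val.simps by blast
    qed
    ultimately show "\<exists>c\<in>tuples N ?W. fm_equiv N X (inst Y b \<phi>) (inst ?W c ?\<theta>)" by blast
  next
    fix b assume b: "b \<in> tuples N Z"
    let ?c = "\<lambda>n\<in>?W. if n \<in> Z then b n else if n = u then p else q"
    have "?c \<in> tuples N ?W" using b assms by (auto simp: tuples_def)
    moreover have "fm_equiv N X (inst Z b \<psi>) (inst ?W ?c ?\<theta>)"
      unfolding fm_equiv_def sat_inst
    proof
      fix a
      let ?v = "\<lambda>n. if n \<in> ?W then ?c n else a n"
      have "sat N (\<lambda>n. if n \<in> Z then b n else a n) \<psi> \<longleftrightarrow> sat N ?v \<psi>"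
        by (rule sat_cong) (use assms u w in \<open>auto simp: formulas_def\<close>)
      moreover have "?v u \<noteq> ?v w" using u w assms(10) by simp
      ultimately show "sat N (\<lambda>n. if n \<in> Z then b n else a n) \<psi> \<longleftrightarrow> sat N ?v ?\<theta>"
        unfolding sat.simps val.simps by blast
    qed
    ultimately show "\<exists>c\<in>tuples N ?W. fm_equiv N X (inst Z b \<psi>) (inst ?W c ?\<theta>)" by blast
  qed
qed

lemma combine_formulas:
  fixes \<phi> :: "nat \<Rightarrow> ('f, 'r, 'a) fm"
  assumes "\<And>k. \<phi> k \<in> formulas L {} (X \<union> Y k)" "\<And>k. finite (Y k)" "\<And>k. X \<inter> Y k = {}"
    and "finite X" "p \<in> universe N" "q \<in> universe N" "p \<noteq> q"
  shows "\<exists>\<theta> W. \<theta> \<in> formulas L {} (X \<union> W) \<and> finite W \<and> X \<inter> W = {} \<and>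
    (\<forall>k\<le>n. \<forall>b\<in>tuples N (Y k). \<exists>c\<in>tuples N W. fm_equiv N X (inst (Y k) b (\<phi> k)) (inst W c \<theta>))"
proof (induction n)
  case 0
  show ?case
    by (rule exI[of _ "\<phi> 0"], rule exI[of _ "Y 0"]) (use assms in \<open>auto simp: fm_equiv_def\<close>)
next
  case (Suc n)
  then obtain \<theta> W where \<theta>: "\<theta> \<in> formulas L {} (X \<union> W)" "finite W" "X \<inter> W = {}"
    and inst: "\<And>k b. k \<le> n \<Longrightarrow> b \<in> tuples N (Y k) \<Longrightarrow>
      \<exists>c\<in>tuples N W. fm_equiv N X (inst (Y k) b (\<phi> k)) (inst W c \<theta>)"
    by blast
  obtain \<theta>' W' where \<theta>': "\<theta>' \<in> formulas L {} (X \<union> W')" "finite W'" "X \<inter> W' = {}"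
    and old: "\<And>b. b \<in> tuples N W \<Longrightarrow> \<exists>c\<in>tuples N W'. fm_equiv N X (inst W b \<theta>) (inst W' c \<theta>')"
    and new: "\<And>b. b \<in> tuples N (Y (Suc n)) \<Longrightarrow>
      \<exists>c\<in>tuples N W'. fm_equiv N X (inst (Y (Suc n)) b (\<phi> (Suc n))) (inst W' c \<theta>')"
    using combine_two_formulas[OF \<theta> assms(1-3)[of "Suc n"] assms(4-7)] by blast
  have trans: "fm_equiv N X \<alpha> \<gamma>" if "fm_equiv N X \<alpha> \<beta>" "fm_equiv N X \<beta> \<gamma>"
    for \<alpha> \<beta> \<gamma> :: "('f, 'r, 'a) fm"
    using that by (auto simp: fm_equiv_def)
  have "\<exists>c\<in>tuples N W'. fm_equiv N X (inst (Y k) b (\<phi> k)) (inst W' c \<theta>')"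
    if "k \<le> Suc n" "b \<in> tuples N (Y k)" for k b
  proof (cases "k = Suc n")
    case False
    then show ?thesis using that inst[of k b] old trans by (metis le_Suc_eq)
  qed (use that new in auto)
  then show ?case using \<theta>' by blast
qed

lemma Av_cong:
  assumes "\<phi> \<in> Lx L N X" "\<psi> \<in> Lx L N X" "fm_equiv N X \<phi> \<psi>" "set as \<subseteq> tuples N X"
  shows "Av L N X as \<phi> = Av L N X as \<psi>"
proof -
  have "sat N (as ! k) \<phi> \<longleftrightarrow> sat N (as ! k) \<psi>" if "k < length as" for k
    using assms(3,4) nth_mem[OF that] unfolding fm_equiv_def by blast
  then have "{k. k < length as \<and> sat N (as ! k) \<phi>} = {k. k < length as \<and> sat N (as ! k) \<psi>}"
    by auto
  then show ?thesis using assms(1,2) by (simp add: Av_def)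
qed

lemma Av_bounds: "\<phi> \<in> Lx L N X \<Longrightarrow> 0 \<le> Av L N X as \<phi> \<and> Av L N X as \<phi> \<le> 1"
proof -
  have "card {k. k < length as \<and> sat N (as ! k) \<phi>} \<le> card {..<length as}"
    by (rule card_mono) auto
  then show "\<phi> \<in> Lx L N X \<Longrightarrow> ?thesis" by (simp add: Av_def divide_le_eq)
qed

text \<open>If there is only one tuple, every formula is equivalent to \<open>TT\<close> or to \<open>FF\<close>. This settles the case
  of a one-element structure, where formulas cannot be coded together.\<close>

lemma keisler_measure_one_tuple:
  assumes "\<mu> \<in> keisler_measures L N X" "tuples N X = {a}" "\<psi> \<in> Lx L N X"
  shows "\<mu> \<psi> = Av L N X [a] \<psi>"
proof -
  have inv: "\<And>\<phi> \<psi>. \<phi> \<in> Lx L N X \<Longrightarrow> \<psi> \<in> Lx L N X \<Longrightarrow> fm_equiv N X \<phi> \<psi> \<Longrightarrow> \<mu> \<phi> = \<mu> \<psi>"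
    and top: "\<mu> TT = 1"
    and add: "\<And>\<phi> \<psi>. \<phi> \<in> Lx L N X \<Longrightarrow> \<psi> \<in> Lx L N X \<Longrightarrow>
      (\<forall>a\<in>tuples N X. \<not> (sat N a \<phi> \<and> sat N a \<psi>)) \<Longrightarrow> \<mu> (Or \<phi> \<psi>) = \<mu> \<phi> + \<mu> \<psi>"
    using assms(1) by (auto simp: keisler_measures_def)
  have Lx: "TT \<in> Lx L N X" "FF \<in> Lx L N X" "Or TT FF \<in> Lx L N X"
    by (auto simp: Lx_def formulas_def)
  have "\<mu> (Or TT FF) = \<mu> TT" by (rule inv) (use Lx in \<open>auto simp: fm_equiv_def\<close>)
  moreover have "\<mu> (Or TT FF) = \<mu> TT + \<mu> FF" by (rule add) (use Lx in auto)
  ultimately have bot: "\<mu> FF = 0" by simp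
  have "{k. k = 0 \<and> sat N ([a] ! k) \<psi>} = (if sat N a \<psi> then {0} else {})" by auto
  then have Av: "Av L N X [a] \<psi> = (if sat N a \<psi> then 1 else 0)"
    using assms(3) by (simp add: Av_def)
  show ?thesis
  proof (cases "sat N a \<psi>")
    case True
    then have "\<mu> \<psi> = \<mu> TT" by (intro inv assms Lx) (simp add: fm_equiv_def assms(2))
    then show ?thesis using True top Av by simp
  next
    case False
    then have "\<mu> \<psi> = \<mu> FF" by (intro inv assms Lx) (simp add: fm_equiv_def assms(2))
    then show ?thesis using False bot Av by simp
  qed
qed

text \<open>Approximating the single formula that codes \<open>\<phi> 0, \<dots>, \<phi> n\<close> approximates all of them, because
  measures and averages do not distinguish equivalent formulas.\<close>

lemma simultaneous_approximation:
  fixes \<phi> :: "nat \<Rightarrow> ('f, 'r, 'a) fm"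
  assumes "\<mu> \<in> keisler_measures L N X" "finitely_approximated L N X \<mu>"
    and "universe N \<noteq> {}" "finite X"
    and \<phi>: "\<And>k. \<phi> k \<in> formulas L {} (X \<union> Y k)" "\<And>k. finite (Y k)" "\<And>k. X \<inter> Y k = {}"
    and "\<epsilon> > 0"
  obtains as where "as \<noteq> []" "set as \<subseteq> tuples N X"
    "\<And>k b. k \<le> n \<Longrightarrow> b \<in> tuples N (Y k) \<Longrightarrow>
      \<bar>\<mu> (inst (Y k) b (\<phi> k)) - Av L N X as (inst (Y k) b (\<phi> k))\<bar> < \<epsilon>"
proof (cases "\<exists>p. universe N = {p}")
  case True
  then obtain p where "universe N = {p}" by blast
  then have tup: "tuples N X = {\<lambda>_\<in>X. p}"
    using PiE_singleton[of "\<lambda>_\<in>X. p" X] by (simp add: tuples_def cong: PiE_cong)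
  show thesis
  proof (rule that[of "[\<lambda>_\<in>X. p]"])
    fix k b assume "b \<in> tuples N (Y k)"
    then show "\<bar>\<mu> (inst (Y k) b (\<phi> k)) - Av L N X [\<lambda>_\<in>X. p] (inst (Y k) b (\<phi> k))\<bar> < \<epsilon>"
      using keisler_measure_one_tuple[OF assms(1) tup inst_in_Lx[OF \<phi>(1)]] \<open>\<epsilon> > 0\<close> by simp
  qed (auto simp: tup)
next
  case False
  then obtain p q where pq: "p \<in> universe N" "q \<in> universe N" "p \<noteq> q"
    using assms(3) by (metis is_singletonI' is_singleton_def)
  obtain \<theta> W where \<theta>: "\<theta> \<in> formulas L {} (X \<union> W)" "finite W" "X \<inter> W = {}"
    and inst: "\<And>k b. k \<le> n \<Longrightarrow> b \<in> tuples N (Y k) \<Longrightarrow>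
      \<exists>c\<in>tuples N W. fm_equiv N X (inst (Y k) b (\<phi> k)) (inst W c \<theta>)"
    using combine_formulas[of \<phi> L X Y p N q n] \<phi> \<open>finite X\<close> pq by blast
  let ?err = "\<lambda>as c. \<bar>\<mu> (inst W c \<theta>) - Av L N X as (inst W c \<theta>)\<bar>"
  have "\<exists>as. as \<noteq> [] \<and> set as \<subseteq> tuples N X \<and> (SUP c\<in>tuples N W. ?err as c) < \<epsilon>"
    using assms(2) \<theta> \<open>\<epsilon> > 0\<close> unfolding finitely_approximated_def by blast
  then obtain as where as: "as \<noteq> []" "set as \<subseteq> tuples N X"
    "(SUP c\<in>tuples N W. ?err as c) < \<epsilon>" by blast
  have range: "\<mu> \<psi> \<in> {0..1}" if "\<psi> \<in> Lx L N X" for \<psi>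
    using assms(1) that by (auto simp: keisler_measures_def)
  \<comment> \<open>boundedness is what makes the supremum an upper bound\<close>
  have "?err as c \<le> 1" if "c \<in> tuples N W" for c
    using range[OF inst_in_Lx[OF \<theta>(1) that]] Av_bounds[OF inst_in_Lx[OF \<theta>(1) that], of as]
    by (simp add: abs_le_iff)
  then have "bdd_above (?err as ` tuples N W)" by (intro bdd_aboveI2)
  then have err: "?err as c < \<epsilon>" if "c \<in> tuples N W" for c
    using cSUP_upper[OF that, of "?err as"] as(3) by simp
  show thesis
  proof (rule that[OF as(1,2)])
    fix k b assume k: "k \<le> n" and b: "b \<in> tuples N (Y k)"
    from inst[OF k b] obtain c where c: "c \<in> tuples N W"
      "fm_equiv N X (inst (Y k) b (\<phi> k)) (inst W c \<theta>)" by blast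
    have Lx: "inst (Y k) b (\<phi> k) \<in> Lx L N X" "inst W c \<theta> \<in> Lx L N X"
      using \<phi>(1) b \<theta>(1) c(1) by (auto intro: inst_in_Lx)
    have "\<mu> (inst (Y k) b (\<phi> k)) = \<mu> (inst W c \<theta>)"
      using assms(1) Lx c(2) by (auto simp: keisler_measures_def)
    then show "\<bar>\<mu> (inst (Y k) b (\<phi> k)) - Av L N X as (inst (Y k) b (\<phi> k))\<bar> < \<epsilon>"
      using Av_cong[OF Lx c(2) as(2)] err[OF c(1)] by simp
  qed
qed

lemma Av_in_conv:
  assumes "as \<noteq> []" "set as \<subseteq> tuples N X"
  shows "Av L N X as \<in> conv L N X"
proof -
  let ?n = "length as"
  have "Av L N X as = (\<lambda>\<phi>\<in>Lx L N X. \<Sum>k<?n. (1 / ?n) * dirac L N X (tp L N X (as ! k)) \<phi>)"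
  proof (rule ext)
    fix \<phi>
    show "Av L N X as \<phi>
        = (\<lambda>\<phi>\<in>Lx L N X. \<Sum>k<?n. (1 / ?n) * dirac L N X (tp L N X (as ! k)) \<phi>) \<phi>"
    proof (cases "\<phi> \<in> Lx L N X")
      case True
      have "(\<Sum>k<?n. (1 / ?n) * dirac L N X (tp L N X (as ! k)) \<phi>)
          = (\<Sum>k<?n. if sat N (as ! k) \<phi> then 1 / ?n else 0)"
        using True by (intro sum.cong) (auto simp: dirac_def tp_def)
      also have "\<dots> = (\<Sum>k\<in>{k. k < ?n \<and> sat N (as ! k) \<phi>}. 1 / ?n)"
        by (simp add: sum.If_cases lessThan_def Collect_conj_eq)
      finally show ?thesis using True by (simp add: Av_def)
    qed (simp add: Av_def)
  qed
  moreover have "(\<Sum>k<?n. 1 / real ?n) = 1" using assms(1) by simp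
  moreover have "\<forall>k<?n. as ! k \<in> tuples N X" using assms(2) nth_mem by blast
  moreover have "?n \<ge> 1" "\<forall>k<?n. 1 / real ?n > 0" using assms(1) by (auto simp: Suc_le_eq)
  ultimately show ?thesis unfolding conv_def mem_Collect_eq
    by (intro exI[of _ ?n] exI[of _ "\<lambda>_. 1 / real ?n"] exI[of _ "(!) as"] conjI)
qed


section \<open>Los's theorem\<close>

abbreviation coord_fm ::
  "'i \<Rightarrow> ('f, 'r, ('i \<Rightarrow> 'a) set) fm \<Rightarrow> ('f, 'r, 'a) fm" where
  "coord_fm i \<equiv> map_fm id id (\<lambda>b. rep b i)"

abbreviation coord_tuple :: "nat set \<Rightarrow> 'i \<Rightarrow> (nat \<Rightarrow> ('i \<Rightarrow> 'a) set) \<Rightarrow> nat \<Rightarrow> 'a" where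
  "coord_tuple X i a \<equiv> (\<lambda>n\<in>X. rep (a n) i)"

locale structure_ultraproduct =
  fixes L :: "('f, 'r) language"
    and D :: "'i filter"
    and M :: "'i \<Rightarrow> ('f, 'r, 'a) fo_structure"
  assumes ultra: "ultrafilter D"
    and structures: "\<And>i. is_structure L (M i)"
begin

abbreviation U :: "('f, 'r, ('i \<Rightarrow> 'a) set) fo_structure" where
  "U \<equiv> ultraproduct D M"

lemma eventually_not_iff: "eventually (\<lambda>i. \<not> P i) D \<longleftrightarrow> \<not> eventually P D"
proof -
  have "eventually P D \<Longrightarrow> eventually (\<lambda>i. \<not> P i) D \<Longrightarrow> False"
    using ultra eventually_conj[of P D "\<lambda>i. \<not> P i"] by (auto simp: ultrafilter_def)
  then show ?thesis using ultra by (auto simp: ultrafilter_def)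
qed

lemma eventually_or_iff:
  "eventually (\<lambda>i. P i \<or> Q i) D \<longleftrightarrow> eventually P D \<or> eventually Q D"
proof -
  have "\<not> eventually (\<lambda>i. P i \<or> Q i) D \<longleftrightarrow> eventually (\<lambda>i. \<not> P i \<and> \<not> Q i) D"
    by (simp flip: eventually_not_iff)
  also have "\<dots> \<longleftrightarrow> \<not> eventually P D \<and> \<not> eventually Q D"
    by (simp add: eventually_conj_iff eventually_not_iff)
  finally show ?thesis by blast
qed

lemma equiv_up_rel: "equiv (\<Pi> i\<in>UNIV. universe (M i)) (up_rel D M)"
proof (rule equivI)
  show "refl_on (\<Pi> i\<in>UNIV. universe (M i)) (up_rel D M)"
    by (auto simp: refl_on_def up_rel_def)
  show "sym (up_rel D M)"
    by (auto simp: sym_def up_rel_def eq_commute)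
  show "trans (up_rel D M)"
  proof (rule transI)
    fix f g h assume "(f, g) \<in> up_rel D M" "(g, h) \<in> up_rel D M"
    then show "(f, h) \<in> up_rel D M"
      by (auto simp: up_rel_def elim: eventually_elim2)
  qed
qed (auto simp: up_rel_def)

lemma universe_U: "universe U = (\<Pi> i\<in>UNIV. universe (M i)) // up_rel D M"
  by (simp add: ultraproduct_def)

lemma rep_in_universe:
  assumes "b \<in> universe U"
  shows "rep b i \<in> universe (M i)"
proof -
  have "b \<noteq> {}" "b \<subseteq> (\<Pi> i\<in>UNIV. universe (M i))"
    using assms equiv_up_rel unfolding universe_U
    by (auto simp: in_quotient_imp_non_empty in_quotient_imp_subset)
  moreover have "rep b \<in> b" using \<open>b \<noteq> {}\<close> unfolding rep_def by (simp add: some_in_eq)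
  ultimately show ?thesis by auto
qed

lemma class_of_section:
  assumes "\<And>i. f i \<in> universe (M i)"
  shows "up_rel D M `` {f} \<in> universe U"
    and "eventually (\<lambda>i. rep (up_rel D M `` {f}) i = f i) D"
proof -
  have f: "f \<in> (\<Pi> i\<in>UNIV. universe (M i))" using assms by auto
  then show "up_rel D M `` {f} \<in> universe U" unfolding universe_U by (rule quotientI)
  have "f \<in> up_rel D M `` {f}" using equiv_up_rel f by (rule equiv_class_self)
  then have "rep (up_rel D M `` {f}) \<in> up_rel D M `` {f}" unfolding rep_def by (rule someI[where P = "\<lambda>f. f \<in> _"])
  then show "eventually (\<lambda>i. rep (up_rel D M `` {f}) i = f i) D"
    by (auto simp: up_rel_def eq_commute)
qed

lemma universe_nonempty: "universe (M i) \<noteq> {}"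
  using structures[of i] by (simp add: is_structure_def)

lemma universe_U_nonempty: "universe U \<noteq> {}"
proof -
  obtain f where "\<And>i. f i \<in> universe (M i)" using universe_nonempty by (meson ex_in_conv)
  then show ?thesis using class_of_section(1) by blast
qed

lemma los_trm:
  assumes "wf_trm L t" "trm_params t \<subseteq> universe U" "\<And>n. n \<in> fv_trm t \<Longrightarrow> v n \<in> universe U"
  shows "val U v t \<in> universe U \<and>
    eventually (\<lambda>i. rep (val U v t) i
      = val (M i) (\<lambda>n. rep (v n) i) (map_trm id (\<lambda>b. rep b i) t)) D"
  using assms
proof (induction t)
  case (Fn f ts)
  have args: "val U v t \<in> universe U \<and>
      eventually (\<lambda>i. rep (val U v t) i
        = val (M i) (\<lambda>n. rep (v n) i) (map_trm id (\<lambda>b. rep b i) t)) D"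
    if "t \<in> set ts" for t
    by (rule Fn.IH[OF that]) (use Fn.prems that in auto)
  let ?f = "\<lambda>i. fn (M i) f (map (\<lambda>t. rep (val U v t) i) ts)"
  have f: "?f i \<in> universe (M i)" for i
  proof -
    have "set (map (\<lambda>t. rep (val U v t) i) ts) \<subseteq> universe (M i)"
      using args rep_in_universe by auto
    then show ?thesis using structures[of i] Fn.prems(1) unfolding is_structure_def by simp
  qed
  have val: "val U v (Fn f ts) = up_rel D M `` {?f}"
    by (simp add: ultraproduct_def comp_def)
  have "eventually (\<lambda>i. \<forall>t\<in>set ts. rep (val U v t) i
        = val (M i) (\<lambda>n. rep (v n) i) (map_trm id (\<lambda>b. rep b i) t)) D"
    using args by (intro eventually_ball_finite) auto
  then have "eventually (\<lambda>i. rep (val U v (Fn f ts)) i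
        = val (M i) (\<lambda>n. rep (v n) i) (map_trm id (\<lambda>b. rep b i) (Fn f ts))) D"
    using class_of_section(2)[of ?f, OF f] unfolding val
  proof eventually_elim
    case (elim i)
    have "map (\<lambda>t. rep (val U v t) i) ts
        = map (val (M i) (\<lambda>n. rep (v n) i)) (map (map_trm id (\<lambda>b. rep b i)) ts)"
      using elim(1) by simp
    then have "fn (M i) f (map (\<lambda>t. rep (val U v t) i) ts)
        = val (M i) (\<lambda>n. rep (v n) i) (map_trm id (\<lambda>b. rep b i) (Fn f ts))"
      by (simp only: trm.map val.simps id_apply)
    then show ?case using elim(2) by (simp only:)
  qed
  then show ?case using class_of_section(1)[of ?f, OF f] unfolding val by blast
qed auto

text \<open>The induction uses the ultrafilter property for negation and disjunction. For \<open>Ex\<close>, witnesses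
  chosen coordinatewise are assembled into one element of the ultraproduct. The valuation
  is constrained on the free variables only, since members of \<open>tuples\<close> are \<open>undefined\<close> elsewhere.\<close>

theorem los:
  assumes "wf_fm L \<phi>" "params \<phi> \<subseteq> universe U" "\<And>n. n \<in> fv \<phi> \<Longrightarrow> v n \<in> universe U"
  shows "sat U v \<phi> \<longleftrightarrow> eventually (\<lambda>i. sat (M i) (\<lambda>n. rep (v n) i) (coord_fm i \<phi>)) D"
  using assms
proof (induction \<phi> arbitrary: v)
  case FF
  then show ?case using ultra by (simp add: ultrafilter_def)
next
  case (Eq s t)
  let ?val = "\<lambda>i t. val (M i) (\<lambda>n. rep (v n) i) (map_trm id (\<lambda>b. rep b i) t)"
  have s: "val U v s \<in> universe U" "eventually (\<lambda>i. rep (val U v s) i = ?val i s) D"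
    using los_trm[of s v] Eq.prems by auto
  have t: "val U v t \<in> universe U" "eventually (\<lambda>i. rep (val U v t) i = ?val i t) D"
    using los_trm[of t v] Eq.prems by auto
  have "val U v s = val U v t \<longleftrightarrow> eventually (\<lambda>i. rep (val U v s) i = rep (val U v t) i) D"
  proof
    assume ev: "eventually (\<lambda>i. rep (val U v s) i = rep (val U v t) i) D"
    have mem: "rep (val U v s) \<in> val U v s" "rep (val U v t) \<in> val U v t"
      using s(1) t(1) equiv_up_rel unfolding universe_U rep_def
      by (simp_all add: some_in_eq in_quotient_imp_non_empty)
    have "(rep (val U v s), rep (val U v t)) \<in> up_rel D M"
      using ev s(1) t(1) rep_in_universe by (auto simp: up_rel_def)
    then show "val U v s = val U v t"
      using quotient_eqI[OF equiv_up_rel] s(1) t(1) mem unfolding universe_U by blast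
  qed simp
  also have "\<dots> \<longleftrightarrow> eventually (\<lambda>i. ?val i s = ?val i t) D"
  proof (rule eventually_cong[OF eventually_conj[OF s(2) t(2)]])
  qed auto
  finally show ?case by (simp flip: id_def)
next
  case (Rel r ts)
  let ?val = "\<lambda>i t. val (M i) (\<lambda>n. rep (v n) i) (map_trm id (\<lambda>b. rep b i) t)"
  have "eventually (\<lambda>i. \<forall>t\<in>set ts. rep (val U v t) i = ?val i t) D"
  proof (intro eventually_ball_finite ballI finite_set)
    fix t assume "t \<in> set ts"
    then show "eventually (\<lambda>i. rep (val U v t) i = ?val i t) D"
      using Rel.prems by (intro los_trm[THEN conjunct2]) auto
  qed
  then have "eventually (\<lambda>i. map (\<lambda>t. rep (val U v t) i) ts = map (?val i) ts) D"
    by (rule eventually_mono) simp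
  then have "eventually (\<lambda>i. rl (M i) r (map (\<lambda>t. rep (val U v t) i) ts)) D
      \<longleftrightarrow> eventually (\<lambda>i. rl (M i) r (map (?val i) ts)) D"
    by (rule eventually_cong) (simp only:)
  moreover have "sat U v (Rel r ts) \<longleftrightarrow> eventually (\<lambda>i. rl (M i) r (map (\<lambda>t. rep (val U v t) i) ts)) D"
    by (simp add: ultraproduct_def comp_def)
  ultimately show ?case by (simp add: comp_def flip: id_def)
next
  case (Neg \<phi>)
  then show ?case by (simp add: eventually_not_iff)
next
  case (Or \<phi> \<psi>)
  then show ?case by (simp add: eventually_or_iff)
next
  case (Ex n \<phi>)
  have IH: "sat U (v(n := c)) \<phi> \<longleftrightarrow>
      eventually (\<lambda>i. sat (M i) ((\<lambda>m. rep (v m) i)(n := rep c i)) (coord_fm i \<phi>)) D"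
    if "c \<in> universe U" for c
  proof -
    have "(\<lambda>m. rep ((v(n := c)) m) i) = (\<lambda>m. rep (v m) i)(n := rep c i)" for i by auto
    moreover have "sat U (v(n := c)) \<phi> \<longleftrightarrow>
        eventually (\<lambda>i. sat (M i) (\<lambda>m. rep ((v(n := c)) m) i) (coord_fm i \<phi>)) D"
      by (rule Ex.IH) (use Ex.prems that in auto)
    ultimately show ?thesis by simp
  qed
  show ?case
  proof
    assume "sat U v (Ex n \<phi>)"
    then obtain c where c: "c \<in> universe U" "sat U (v(n := c)) \<phi>" by auto
    then have "eventually (\<lambda>i. sat (M i) ((\<lambda>m. rep (v m) i)(n := rep c i)) (coord_fm i \<phi>)) D"
      using IH by simp
    then show "eventually (\<lambda>i. sat (M i) (\<lambda>n. rep (v n) i) (coord_fm i (Ex n \<phi>))) D"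
      by (rule eventually_mono) (use rep_in_universe[OF c(1)] in auto)
  next
    assume ev: "eventually (\<lambda>i. sat (M i) (\<lambda>n. rep (v n) i) (coord_fm i (Ex n \<phi>))) D"
    let ?P = "\<lambda>i c. sat (M i) ((\<lambda>m. rep (v m) i)(n := c)) (coord_fm i \<phi>)"
    have "\<exists>c. c \<in> universe (M i) \<and> ((\<exists>c\<in>universe (M i). ?P i c) \<longrightarrow> ?P i c)" for i
      using universe_nonempty[of i] by blast
    then obtain w where w: "\<And>i. w i \<in> universe (M i)"
      "\<And>i. (\<exists>c\<in>universe (M i). ?P i c) \<Longrightarrow> ?P i (w i)" by metis
    let ?c = "up_rel D M `` {w}"
    have "eventually (\<lambda>i. ?P i (rep ?c i)) D"
      using ev class_of_section(2)[of w, OF w(1)]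
      by eventually_elim (use w(2) in auto)
    then show "sat U v (Ex n \<phi>)"
      using IH class_of_section(1)[of w, OF w(1)] by auto
  qed
qed


section \<open>Coordinates of average measures\<close>

lemma coord_tuple_in_tuples: "a \<in> tuples U X \<Longrightarrow> coord_tuple X i a \<in> tuples (M i) X"
  using rep_in_universe by (auto simp: tuples_def)

lemma coord_fm_in_Lx: "\<psi> \<in> Lx L U X \<Longrightarrow> coord_fm i \<psi> \<in> Lx L (M i) X"
  using rep_in_universe by (auto simp: Lx_def formulas_def wf_fm_map fv_map fm.set_map)

lemma los_tuple:
  assumes "a \<in> tuples U X" "\<psi> \<in> Lx L U X"
  shows "sat U a \<psi> \<longleftrightarrow> eventually (\<lambda>i. sat (M i) (coord_tuple X i a) (coord_fm i \<psi>)) D"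
proof -
  have \<psi>: "wf_fm L \<psi>" "params \<psi> \<subseteq> universe U" "fv \<psi> \<subseteq> X"
    using assms(2) by (auto simp: Lx_def formulas_def)
  have "sat (M i) (\<lambda>n. rep (a n) i) (coord_fm i \<psi>)
      \<longleftrightarrow> sat (M i) (coord_tuple X i a) (coord_fm i \<psi>)" for i
    by (rule sat_cong) (use \<psi>(3) in \<open>auto simp: fv_map\<close>)
  moreover have "sat U a \<psi> \<longleftrightarrow> eventually (\<lambda>i. sat (M i) (\<lambda>n. rep (a n) i) (coord_fm i \<psi>)) D"
    using los[OF \<psi>(1,2), of a] assms(1) \<psi>(3) by (auto simp: tuples_def)
  ultimately show ?thesis by simp
qed

abbreviation coord_Av ::
  "nat set \<Rightarrow> 'i \<Rightarrow> (nat \<Rightarrow> ('i \<Rightarrow> 'a) set) list \<Rightarrow> ('f, 'r, 'a) fm \<Rightarrow> real" where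
  "coord_Av X i as \<equiv> Av L (M i) X (map (coord_tuple X i) as)"

text \<open>An average is determined by the truth values at finitely many tuples, so there is almost everywhere
  equality and not only convergence.\<close>

lemma eventually_coord_Av:
  assumes "set as \<subseteq> tuples U X" "\<psi> \<in> Lx L U X"
  shows "eventually (\<lambda>i. coord_Av X i as (coord_fm i \<psi>) = Av L U X as \<psi>) D"
proof -
  have "eventually (\<lambda>i. sat (M i) (coord_tuple X i a) (coord_fm i \<psi>) \<longleftrightarrow> sat U a \<psi>) D"
    if "a \<in> set as" for a
  proof -
    have "a \<in> tuples U X" using assms(1) that by blast
    note los = los_tuple[OF this assms(2)]
    show ?thesis
    proof (cases "sat U a \<psi>")
      case True
      then show ?thesis using los by (simp only: simp_thms)
    next
      case False
      then show ?thesis using los by (simp only: simp_thms eventually_not_iff)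
    qed
  qed
  then have "eventually (\<lambda>i. \<forall>a\<in>set as.
      sat (M i) (coord_tuple X i a) (coord_fm i \<psi>) \<longleftrightarrow> sat U a \<psi>) D"
    by (intro eventually_ball_finite) auto
  then show ?thesis
  proof eventually_elim
    case (elim i)
    have "{k. k < length as \<and> sat (M i) (map (coord_tuple X i) as ! k) (coord_fm i \<psi>)}
        = {k. k < length as \<and> sat U (as ! k) \<psi>}"
      using elim by (intro Collect_cong conj_cong) simp_all
    then show ?case using assms(2) coord_fm_in_Lx[OF assms(2)] by (simp add: Av_def)
  qed
qed

text \<open>Closeness for each single \<open>b\<close> transfers by \<open>eventually_coord_Av\<close>, but on a set of indices that
  depends on \<open>b\<close>. For uniformity, pick for each \<open>i\<close> a tuple \<open>w i\<close> that is a counterexample at \<open>i\<close>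
  if there is one, and let \<open>c\<close> be the tuple of the ultraproduct whose \<open>i\<close>-th coordinate is that of
  \<open>w i\<close>. Closeness at the one tuple \<open>c\<close> shows that almost nowhere is there a counterexample.\<close>

lemma uniform_closeness_transfers:
  assumes "set as \<subseteq> tuples U X" "set bs \<subseteq> tuples U X"
    and \<phi>: "\<phi> \<in> formulas L {} (X \<union> Y)" "finite Y"
    and close: "\<And>b. b \<in> tuples U Y \<Longrightarrow>
      \<bar>Av L U X as (inst Y b \<phi>) - Av L U X bs (inst Y b \<phi>)\<bar> \<le> \<delta>"
  shows "eventually (\<lambda>i. \<forall>b\<in>tuples U Y.
    \<bar>coord_Av X i as (coord_fm i (inst Y b \<phi>)) - coord_Av X i bs (coord_fm i (inst Y b \<phi>))\<bar> \<le> \<delta>) D"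
proof -
  let ?good = "\<lambda>i b. \<bar>coord_Av X i as (coord_fm i (inst Y b \<phi>))
      - coord_Av X i bs (coord_fm i (inst Y b \<phi>))\<bar> \<le> \<delta>"
  have "tuples U Y \<noteq> {}" using universe_U_nonempty by (simp add: tuples_def PiE_eq_empty_iff)
  then have "\<forall>i. \<exists>b. b \<in> tuples U Y \<and> (?good i b \<longrightarrow> (\<forall>b\<in>tuples U Y. ?good i b))" by blast
  from choice[OF this] obtain w where w: "\<And>i. w i \<in> tuples U Y"
    "\<And>i. ?good i (w i) \<Longrightarrow> \<forall>b\<in>tuples U Y. ?good i b" by blast
  have sec: "rep (w i n) i \<in> universe (M i)" if "n \<in> Y" for i n
    using w(1)[of i] that rep_in_universe by (auto simp: tuples_def)
  let ?c = "\<lambda>n\<in>Y. up_rel D M `` {\<lambda>i. rep (w i n) i}"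
  have c: "?c \<in> tuples U Y" using class_of_section(1) sec by (auto simp: tuples_def)
  have "eventually (\<lambda>i. \<forall>n\<in>Y. rep (?c n) i = rep (w i n) i) D"
    using class_of_section(2) sec \<phi>(2) by (intro eventually_ball_finite) auto
  moreover note eventually_coord_Av[OF assms(1) inst_in_Lx[OF \<phi>(1) c]]
    eventually_coord_Av[OF assms(2) inst_in_Lx[OF \<phi>(1) c]]
  ultimately show ?thesis
  proof eventually_elim
    case (elim i)
    have "coord_fm i (inst Y (w i) \<phi>) = coord_fm i (inst Y ?c \<phi>)"
      by (rule map_inst_cong) (use elim(1) in simp)
    then have "?good i (w i)" using elim(2,3) close[OF c] by simp
    then show ?case by (rule w(2))
  qed
qed

end

section \<open>Diagonalisation along the ultrafilter\<close>

text \<open>Intersecting a sequence of large sets with empty intersection with the sets where \<open>P 0, \<dots>, P n\<close>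
  hold yields a decreasing sequence of large sets that every \<open>i\<close> eventually leaves. The last stage
  containing \<open>i\<close> is \<open>N i\<close>.\<close>

lemma countably_incomplete_diagonal:
  assumes "countably_incomplete D" "\<And>n. eventually (P n) D"
  obtains N :: "'i \<Rightarrow> nat" where "\<And>m. eventually (\<lambda>i. m \<le> N i \<and> P (N i) i) D"
proof -
  obtain S :: "nat \<Rightarrow> 'i set" where S: "\<And>n. eventually (\<lambda>i. i \<in> S n) D" "(\<Inter>n. S n) = {}"
    using assms(1) unfolding countably_incomplete_def by blast
  define Q where "Q n i \<longleftrightarrow> (\<forall>j\<le>n. i \<in> S j \<and> P j i)" for n i
  have ev: "eventually (Q n) D" for n
  proof -
    have "eventually (\<lambda>i. \<forall>j\<in>{..n}. i \<in> S j \<and> P j i) D"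
      using S(1) assms(2) by (intro eventually_ball_finite) (auto intro: eventually_conj)
    then show ?thesis by (simp add: Q_def[abs_def] Ball_def)
  qed
  \<comment> \<open>indices that are outside stage \<open>0\<close> also get \<open>N i = 0\<close>; they form a small set\<close>
  define N where "N i = (LEAST n. \<not> Q n i) - 1" for i
  have "m \<le> N i \<and> P (N i) i" if "Q m i" for m i
  proof -
    have "\<exists>n. \<not> Q n i" using S(2) unfolding Q_def by blast
    then have least: "\<not> Q (LEAST n. \<not> Q n i) i" by (rule LeastI_ex)
    have "m < (LEAST n. \<not> Q n i)"
    proof (rule ccontr)
      assume "\<not> m < (LEAST n. \<not> Q n i)"
      then have "Q (LEAST n. \<not> Q n i) i" using that by (auto simp: Q_def)
      then show False using least by contradiction
    qed
    then have "m \<le> N i" "N i < (LEAST n. \<not> Q n i)" by (auto simp: N_def)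
    then show ?thesis using not_less_Least[of "N i" "\<lambda>n. \<not> Q n i"] by (auto simp: Q_def)
  qed
  then show thesis by (intro that[of N] eventually_mono[OF ev])
qed

theorem theorem3p5:
  fixes L :: "('f, 'r) language"
    and D :: "'i filter"
    and M :: "'i \<Rightarrow> ('f, 'r, 'a) fo_structure"
    and X :: "nat set"
    and \<mu> :: "('f, 'r, ('i \<Rightarrow> 'a) set) fm \<Rightarrow> real"
  assumes "countable_language L"
    and "infinite (UNIV :: 'i set)"
    and "ultrafilter D" and "nonprincipal D" and "countably_incomplete D"
    and "\<And>i. is_structure L (M i)"
    and "finite X"
    and "\<mu> \<in> keisler_measures L (ultraproduct D M) X"
    and "finitely_approximated L (ultraproduct D M) X \<mu>"
  shows "pseudo_finite L D M X \<mu>"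
proof -
  interpret structure_ultraproduct L D M by unfold_locales (use assms in auto)
  let ?F = "{\<phi> :: ('f, 'r, ('i \<Rightarrow> 'a) set) fm. wf_fm L \<phi> \<and> params \<phi> = {}}"
  have "FF \<in> ?F" by simp
  then have ne: "?F \<noteq> {}" by blast
  define \<phi> where "\<phi> = from_nat_into ?F"
  define Y where "Y k = fv (\<phi> k) - X" for k
  have range: "range \<phi> = ?F"
    unfolding \<phi>_def using range_from_nat_into[OF ne countable_parameter_free[OF assms(1)]] .
  have \<phi>: "\<phi> k \<in> formulas L {} (X \<union> Y k)" "finite (Y k)" "X \<inter> Y k = {}" for k
  proof -
    have "\<phi> k \<in> ?F" using range by blast
    then show "\<phi> k \<in> formulas L {} (X \<union> Y k)" by (auto simp: formulas_def Y_def)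
  qed (auto simp: Y_def finite_fv)
  have "\<exists>as. as \<noteq> [] \<and> set as \<subseteq> tuples U X \<and> (\<forall>k\<le>m. \<forall>b\<in>tuples U (Y k).
      \<bar>\<mu> (inst (Y k) b (\<phi> k)) - Av L U X as (inst (Y k) b (\<phi> k))\<bar> < 1 / real (Suc m))" for m
  proof -
    have "(0::real) < 1 / real (Suc m)" by simp
    from simultaneous_approximation[where \<phi> = \<phi> and Y = Y and n = m,
        OF assms(8,9) universe_U_nonempty \<open>finite X\<close> \<phi> this]
    show ?thesis by metis
  qed
  then obtain A where A: "\<And>m. A m \<noteq> []" "\<And>m. set (A m) \<subseteq> tuples U X"
    and approx: "\<And>m k b. k \<le> m \<Longrightarrow> b \<in> tuples U (Y k) \<Longrightarrow>
      \<bar>\<mu> (inst (Y k) b (\<phi> k)) - Av L U X (A m) (inst (Y k) b (\<phi> k))\<bar> < 1 / real (Suc m)"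
    by metis
  \<comment> \<open>\<open>2/(m+1)\<close> bounds \<open>1/(m+1) + 1/(n+1)\<close> as \<open>m \<le> n\<close>\<close>
  define close where "close n i \<longleftrightarrow> (\<forall>m\<in>{..n}. \<forall>k\<in>{..m}. \<forall>b\<in>tuples U (Y k).
      \<bar>coord_Av X i (A m) (coord_fm i (inst (Y k) b (\<phi> k)))
        - coord_Av X i (A n) (coord_fm i (inst (Y k) b (\<phi> k)))\<bar> \<le> 2 / real (Suc m))" for n i
  have "eventually (close n) D" for n
    unfolding close_def[abs_def]
  proof (rule eventually_ball_finite[OF finite_atMost], rule ballI,
      rule eventually_ball_finite[OF finite_atMost], rule ballI)
    fix m k assume mk: "m \<in> {..n}" "k \<in> {..m}"
    show "eventually (\<lambda>i. \<forall>b\<in>tuples U (Y k).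
      \<bar>coord_Av X i (A m) (coord_fm i (inst (Y k) b (\<phi> k)))
        - coord_Av X i (A n) (coord_fm i (inst (Y k) b (\<phi> k)))\<bar> \<le> 2 / real (Suc m)) D"
    proof (rule uniform_closeness_transfers[OF A(2) A(2) \<phi>(1,2)])
      fix b assume b: "b \<in> tuples U (Y k)"
      have "1 / real (Suc n) \<le> 1 / real (Suc m)" using mk by (simp add: frac_le)
      then show "\<bar>Av L U X (A m) (inst (Y k) b (\<phi> k)) - Av L U X (A n) (inst (Y k) b (\<phi> k))\<bar>
          \<le> 2 / real (Suc m)"
        using approx[OF _ b, of m] approx[OF _ b, of n] mk by auto
    qed
  qed
  then obtain N where N: "\<And>m. eventually (\<lambda>i. m \<le> N i \<and> close (N i) i) D"
    using countably_incomplete_diagonal[OF assms(5), of close] by blast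
  define \<mu>s where "\<mu>s i = coord_Av X i (A (N i))" for i
  have "\<mu>s i \<in> conv L (M i) X" for i
    unfolding \<mu>s_def using A coord_tuple_in_tuples by (intro Av_in_conv) (auto simp: subset_iff)
  moreover have lim: "((\<lambda>i. \<mu>s i (coord_fm i \<psi>)) \<longlongrightarrow> \<mu> \<psi>) D" if \<psi>: "\<psi> \<in> Lx L U X" for \<psi>
  proof (rule tendstoI)
    fix \<epsilon> :: real assume "\<epsilon> > 0"
    obtain \<phi>' b where \<phi>': "wf_fm L \<phi>'" "params \<phi>' = {}" "b \<in> tuples U (fv \<phi>' - X)"
      "\<psi> = inst (fv \<phi>' - X) b \<phi>'"
      using formula_is_instance[OF \<psi> \<open>finite X\<close>] .
    moreover obtain k where "\<phi>' = \<phi> k" using \<phi>'(1,2) range by blast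
    ultimately have b: "b \<in> tuples U (Y k)" "\<psi> = inst (Y k) b (\<phi> k)" by (auto simp: Y_def)
    \<comment> \<open>\<open>m \<ge> k\<close> brings \<open>\<phi> k\<close> into range; \<open>3 = 2 + 1\<close> adds the error of \<open>close\<close> to that of \<open>A m\<close>\<close>
    obtain m\<^sub>0 where "3 / \<epsilon> < real m\<^sub>0" using reals_Archimedean2 by blast
    define m where "m = max k m\<^sub>0"
    have "3 / \<epsilon> < real (Suc m)" using \<open>3 / \<epsilon> < real m\<^sub>0\<close> by (simp add: m_def)
    then have m: "3 / real (Suc m) < \<epsilon>" using \<open>\<epsilon> > 0\<close> by (simp add: field_simps)
    have "k \<le> m" by (simp add: m_def)
    show "eventually (\<lambda>i. dist (\<mu>s i (coord_fm i \<psi>)) (\<mu> \<psi>) < \<epsilon>) D"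
      using N[of m] eventually_coord_Av[OF A(2)[of m] \<psi>]
    proof eventually_elim
      case (elim i)
      have "\<bar>coord_Av X i (A m) (coord_fm i \<psi>) - \<mu>s i (coord_fm i \<psi>)\<bar> \<le> 2 / real (Suc m)"
        using elim(1) \<open>k \<le> m\<close> b unfolding close_def \<mu>s_def by auto
      moreover have "\<bar>\<mu> \<psi> - coord_Av X i (A m) (coord_fm i \<psi>)\<bar> < 1 / real (Suc m)"
        using approx[OF \<open>k \<le> m\<close> b(1)] b(2) elim(2) by simp
      moreover have "2 / real (Suc m) + 1 / real (Suc m) = 3 / real (Suc m)"
        by (simp flip: add_divide_distrib)
      ultimately show ?case using m by (simp add: dist_real_def)
    qed
  qed
  have "ultralimit L D M X \<mu>s = \<mu>"
  proof (rule ext)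
    fix \<psi>
    show "ultralimit L D M X \<mu>s \<psi> = \<mu> \<psi>"
    proof (cases "\<psi> \<in> Lx L U X")
      case True
      have "\<not> trivial_limit D" using assms(3) by (simp add: ultrafilter_def)
      then show ?thesis using True tendsto_Lim[OF _ lim[OF True]] by (simp add: ultralimit_def)
    next
      case False
      have "\<mu> \<in> extensional (Lx L U X)" using assms(8) by (auto simp: keisler_measures_def PiE_def)
      then show ?thesis using False by (simp add: ultralimit_def extensional_def)
    qed
  qed
  ultimately show ?thesis unfolding pseudo_finite_def by blast
qed

end
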